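(* Let $\mathbb{K}=(G,M,I)$ be a formal context and $\mathbb{K}^c=(G,M,I^c)$ its complemented context ($I^c=(G\times M)\setminus I$). Let $Fm_{FC}$ be the set of logical formal concepts of $\mathbb{K}$, and let $Fm_{PC}$ and $Fm_{OC}$ be the sets of logical property oriented concepts and logical object oriented concepts of $\mathbb{K}^c$, respectively. Then (a) $(Fm_{FC}/\equiv_3,\vee_3,\wedge_3)$ and $(Fm_{PC}/\equiv_1,\vee_1,\wedge_1)$ are isomorphic; (b) $(Fm_{PC}/\equiv_1,\vee_1,\wedge_1)$ and $(Fm_{OC}/\equiv_2,\vee_2,\wedge_2)$ are dually isomorphic; (c) $(Fm_{FC}/\equiv_3,\vee_3,\wedge_3)$ and $(Fm_{OC}/\equiv_2,\vee_2,\wedge_2)$ are dually isomorphic.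
   Context: Sorts $s_1,s_2$, disjoint nonempty variable sets. $Fm(\mathbf{RS})$: $\mathbf{KB}_2$-formulas, each sort closed under $\neg,\wedge$; $\lozenge\phi,\square\phi$ of sort $s_2$ for $\phi$ of sort $s_1$; $\lozenge^{-1}\psi,\square^{-1}\psi$ of sort $s_1$ for $\psi$ of sort $s_2$. $\mathbf{KF}$-formulas: same with $\boxminus$ (sort $s_1\to s_2$), $\boxminus^{-1}$ (sort $s_2\to s_1$). For a context $\mathbb{L}=(G,M,J)$ its frame is $(G,M,J^{-1},J)$; models on it have worlds of sort $s_1$ in $G$, of sort $s_2$ in $M$, plus a valuation; at $m\in M$, $\lozenge\phi$ iff some $g$ with $gJm$ satisfies $\phi$, $\square\phi$ iff all such $g$ do; at $g\in G$, $\lozenge^{-1}\psi$ iff some $m$ with $gJm$ satisfies $\psi$, $\square^{-1}\psi$ iff all such $m$ do; $\boxminus\phi$ holds at $m$ iff every $g$ satisfying $\phi$ has $gJm$; $\boxminus^{-1}\psi$ holds at $g$ iff every $m$ satisfying $\psi$ has $gJm$. $\models_{\mathbb L}\chi$: $\chi$ holds at every world of its sort in every model on the frame of $\mathbb L$. Logical property oriented concepts of $\mathbb L$ ($Fm_{PC}$): pairs $(\phi,\psi)$ of $Fm(\mathbf{RS})$-formulas of sorts $s_1,s_2$ with $\models_{\mathbb L}\square^{-1}\lozenge\phi\leftrightarrow\phi$, $\models_{\mathbb L}\lozenge\square^{-1}\psi\leftrightarrow\psi$, $\models_{\mathbb L}\phi\leftrightarrow\square^{-1}\psi$, $\models_{\mathbb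 L}\lozenge\phi\leftrightarrow\psi$. Logical object oriented concepts ($Fm_{OC}$): pairs with $\models_{\mathbb L}\lozenge^{-1}\square\phi\leftrightarrow\phi$, $\models_{\mathbb L}\square\lozenge^{-1}\psi\leftrightarrow\psi$, $\models_{\mathbb L}\phi\leftrightarrow\lozenge^{-1}\psi$, $\models_{\mathbb L}\square\phi\leftrightarrow\psi$. Logical formal concepts ($Fm_{FC}$): pairs of $\mathbf{KF}$-formulas with $\models_{\mathbb L}\boxminus^{-1}\boxminus\phi\leftrightarrow\phi$, $\models_{\mathbb L}\boxminus\boxminus^{-1}\psi\leftrightarrow\psi$, $\models_{\mathbb L}\phi\leftrightarrow\boxminus^{-1}\psi$, $\models_{\mathbb L}\boxminus\phi\leftrightarrow\psi$. On each such set (with $\mathbb L$ the context it is taken over), $(\phi,\psi)\equiv(\phi',\psi')$ iff $\models_{\mathbb L}\phi\leftrightarrow\phi'$ ($\equiv_1,\equiv_2,\equiv_3$ for $PC,OC,FC$); $[\cdot]$ denotes classes. Operations: $[(\phi,\psi)]\wedge_1[(\phi',\psi')]=[(\phi\wedge\phi',\lozenge(\phi\wedge\phi'))]$, $[(\phi,\psi)]\vee_1[(\phi',\psi')]=[(\square^{-1}(\psi\wedge\psi'),\psi\wedge\psi')]$; $[(\phi,\psi)]\wedge_2[(\phi',\psi')]=[(\phi\wedge\phi',\square(\phi\wedge\phi'))]$, $[(\phi,\psi)]\vee_2[(\phi',\psi')]=[(\lozenge^{-1}(\psi\wedge\psi'),\psi\wedge\psi')]$; $[(\phi,\psi)]\wedge_3[(\phi',\psi')]=[(\phi\wedge\phi',\boxminus(\phi\wedge\phi'))]$,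 $[(\phi,\psi)]\vee_3[(\phi',\psi')]=[(\boxminus^{-1}(\psi\wedge\psi'),\psi\wedge\psi')]$.
   Formalization: As printed, ∨₁, ∧₂, ∨₂ make (a), (c) false (G=M one point, I empty: ∨₁=∧₁, ∨₂=∧₂). Proved with ∨₁ = [(□⁻¹(ψ∨ψ'), ψ∨ψ')], ∧₂ = [(◇⁻¹(ψ∧ψ'), ψ∧ψ')] (printed as ∨₂), ∨₂ = [(φ∨φ', □(φ∨φ'))]. *)

theory Defs
  imports Main
begin

record ('g, 'm) ctxt =
  Obj :: "'g set"
  Att :: "'m set"
  Inc :: "('g \<times> 'm) set"

definition formal_context :: "('g, 'm) ctxt \<Rightarrow> bool" where
  "formal_context K \<longleftrightarrow> Inc K \<subseteq> Obj K \<times> Att K"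

definition compl_context :: "('g, 'm) ctxt \<Rightarrow> ('g, 'm) ctxt" where
  "compl_context K = \<lparr>Obj = Obj K, Att = Att K, Inc = Obj K \<times> Att K - Inc K\<rparr>"

text \<open>Formulas of sort \<open>s\<^sub>1\<close> and \<open>s\<^sub>2\<close> are two mutually recursive datatypes. The types \<open>'p\<close> and
  \<open>'q\<close> supply the propositional variables of sort \<open>s\<^sub>1\<close> and \<open>s\<^sub>2\<close>; being types, they are nonempty,
  and distinct constructors keep the variables of the two sorts apart.\<close>

datatype ('p, 'q) kb1 =
    KBVar1 'p
  | KBNeg1 "('p, 'q) kb1"
  | KBAnd1 "('p, 'q) kb1" "('p, 'q) kb1"
  | DiaInv "('p, 'q) kb2"
  | BoxInv "('p, 'q) kb2"
and ('p, 'q) kb2 =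
    KBVar2 'q
  | KBNeg2 "('p, 'q) kb2"
  | KBAnd2 "('p, 'q) kb2" "('p, 'q) kb2"
  | Dia "('p, 'q) kb1"
  | Box "('p, 'q) kb1"

text \<open>\<open>WinInv\<close> and \<open>Win\<close> are the window modalities \<open>\<boxminus>\<inverse>\<close> and \<open>\<boxminus>\<close>.\<close>

datatype ('p, 'q) kf1 =
    KFVar1 'p
  | KFNeg1 "('p, 'q) kf1"
  | KFAnd1 "('p, 'q) kf1" "('p, 'q) kf1"
  | WinInv "('p, 'q) kf2"
and ('p, 'q) kf2 =
    KFVar2 'q
  | KFNeg2 "('p, 'q) kf2"
  | KFAnd2 "('p, 'q) kf2" "('p, 'q) kf2"
  | Win "('p, 'q) kf1"

abbreviation KBOr1 :: "('p, 'q) kb1 \<Rightarrow> ('p, 'q) kb1 \<Rightarrow> ('p, 'q) kb1" where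
  "KBOr1 \<phi> \<phi>' \<equiv> KBNeg1 (KBAnd1 (KBNeg1 \<phi>) (KBNeg1 \<phi>'))"

abbreviation KBOr2 :: "('p, 'q) kb2 \<Rightarrow> ('p, 'q) kb2 \<Rightarrow> ('p, 'q) kb2" where
  "KBOr2 \<psi> \<psi>' \<equiv> KBNeg2 (KBAnd2 (KBNeg2 \<psi>) (KBNeg2 \<psi>'))"

abbreviation KBIff1 :: "('p, 'q) kb1 \<Rightarrow> ('p, 'q) kb1 \<Rightarrow> ('p, 'q) kb1" where
  "KBIff1 \<phi> \<phi>' \<equiv> KBAnd1 (KBNeg1 (KBAnd1 \<phi> (KBNeg1 \<phi>'))) (KBNeg1 (KBAnd1 \<phi>' (KBNeg1 \<phi>)))"

abbreviation KBIff2 :: "('p, 'q) kb2 \<Rightarrow> ('p, 'q) kb2 \<Rightarrow> ('p, 'q) kb2" where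
  "KBIff2 \<psi> \<psi>' \<equiv> KBAnd2 (KBNeg2 (KBAnd2 \<psi> (KBNeg2 \<psi>'))) (KBNeg2 (KBAnd2 \<psi>' (KBNeg2 \<psi>)))"

abbreviation KFIff1 :: "('p, 'q) kf1 \<Rightarrow> ('p, 'q) kf1 \<Rightarrow> ('p, 'q) kf1" where
  "KFIff1 \<phi> \<phi>' \<equiv> KFAnd1 (KFNeg1 (KFAnd1 \<phi> (KFNeg1 \<phi>'))) (KFNeg1 (KFAnd1 \<phi>' (KFNeg1 \<phi>)))"

abbreviation KFIff2 :: "('p, 'q) kf2 \<Rightarrow> ('p, 'q) kf2 \<Rightarrow> ('p, 'q) kf2" where
  "KFIff2 \<psi> \<psi>' \<equiv> KFAnd2 (KFNeg2 (KFAnd2 \<psi> (KFNeg2 \<psi>'))) (KFNeg2 (KFAnd2 \<psi>' (KFNeg2 \<psi>)))"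

text \<open>A model on the frame of a context consists of the context and a valuation \<open>(V1, V2)\<close>.
  The truth clauses are spelled out with the incidence relation of the context.\<close>

primrec kb_sat1 :: "('g, 'm) ctxt \<Rightarrow> ('p \<Rightarrow> 'g set) \<Rightarrow> ('q \<Rightarrow> 'm set) \<Rightarrow> 'g \<Rightarrow> ('p, 'q) kb1 \<Rightarrow> bool"
  and kb_sat2 :: "('g, 'm) ctxt \<Rightarrow> ('p \<Rightarrow> 'g set) \<Rightarrow> ('q \<Rightarrow> 'm set) \<Rightarrow> 'm \<Rightarrow> ('p, 'q) kb2 \<Rightarrow> bool" where
  "kb_sat1 L V1 V2 g (KBVar1 p) \<longleftrightarrow> g \<in> V1 p"
| "kb_sat1 L V1 V2 g (KBNeg1 \<phi>) \<longleftrightarrow> \<not> kb_sat1 L V1 V2 g \<phi>"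
| "kb_sat1 L V1 V2 g (KBAnd1 \<phi> \<phi>') \<longleftrightarrow> kb_sat1 L V1 V2 g \<phi> \<and> kb_sat1 L V1 V2 g \<phi>'"
| "kb_sat1 L V1 V2 g (DiaInv \<psi>) \<longleftrightarrow> (\<exists>m\<in>Att L. (g, m) \<in> Inc L \<and> kb_sat2 L V1 V2 m \<psi>)"
| "kb_sat1 L V1 V2 g (BoxInv \<psi>) \<longleftrightarrow> (\<forall>m\<in>Att L. (g, m) \<in> Inc L \<longrightarrow> kb_sat2 L V1 V2 m \<psi>)"
| "kb_sat2 L V1 V2 m (KBVar2 q) \<longleftrightarrow> m \<in> V2 q"
| "kb_sat2 L V1 V2 m (KBNeg2 \<psi>) \<longleftrightarrow> \<not> kb_sat2 L V1 V2 m \<psi>"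
| "kb_sat2 L V1 V2 m (KBAnd2 \<psi> \<psi>') \<longleftrightarrow> kb_sat2 L V1 V2 m \<psi> \<and> kb_sat2 L V1 V2 m \<psi>'"
| "kb_sat2 L V1 V2 m (Dia \<phi>) \<longleftrightarrow> (\<exists>g\<in>Obj L. (g, m) \<in> Inc L \<and> kb_sat1 L V1 V2 g \<phi>)"
| "kb_sat2 L V1 V2 m (Box \<phi>) \<longleftrightarrow> (\<forall>g\<in>Obj L. (g, m) \<in> Inc L \<longrightarrow> kb_sat1 L V1 V2 g \<phi>)"

primrec kf_sat1 :: "('g, 'm) ctxt \<Rightarrow> ('p \<Rightarrow> 'g set) \<Rightarrow> ('q \<Rightarrow> 'm set) \<Rightarrow> 'g \<Rightarrow> ('p, 'q) kf1 \<Rightarrow> bool"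
  and kf_sat2 :: "('g, 'm) ctxt \<Rightarrow> ('p \<Rightarrow> 'g set) \<Rightarrow> ('q \<Rightarrow> 'm set) \<Rightarrow> 'm \<Rightarrow> ('p, 'q) kf2 \<Rightarrow> bool" where
  "kf_sat1 L V1 V2 g (KFVar1 p) \<longleftrightarrow> g \<in> V1 p"
| "kf_sat1 L V1 V2 g (KFNeg1 \<phi>) \<longleftrightarrow> \<not> kf_sat1 L V1 V2 g \<phi>"
| "kf_sat1 L V1 V2 g (KFAnd1 \<phi> \<phi>') \<longleftrightarrow> kf_sat1 L V1 V2 g \<phi> \<and> kf_sat1 L V1 V2 g \<phi>'"
| "kf_sat1 L V1 V2 g (WinInv \<psi>) \<longleftrightarrow> (\<forall>m\<in>Att L. kf_sat2 L V1 V2 m \<psi> \<longrightarrow> (g, m) \<in> Inc L)"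
| "kf_sat2 L V1 V2 m (KFVar2 q) \<longleftrightarrow> m \<in> V2 q"
| "kf_sat2 L V1 V2 m (KFNeg2 \<psi>) \<longleftrightarrow> \<not> kf_sat2 L V1 V2 m \<psi>"
| "kf_sat2 L V1 V2 m (KFAnd2 \<psi> \<psi>') \<longleftrightarrow> kf_sat2 L V1 V2 m \<psi> \<and> kf_sat2 L V1 V2 m \<psi>'"
| "kf_sat2 L V1 V2 m (Win \<phi>) \<longleftrightarrow> (\<forall>g\<in>Obj L. kf_sat1 L V1 V2 g \<phi> \<longrightarrow> (g, m) \<in> Inc L)"

definition valuation :: "('g, 'm) ctxt \<Rightarrow> ('p \<Rightarrow> 'g set) \<Rightarrow> ('q \<Rightarrow> 'm set) \<Rightarrow> bool" where
  "valuation L V1 V2 \<longleftrightarrow> (\<forall>p. V1 p \<subseteq> Obj L) \<and> (\<forall>q. V2 q \<subseteq> Att L)"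

definition kb_valid1 :: "('g, 'm) ctxt \<Rightarrow> ('p, 'q) kb1 \<Rightarrow> bool" where
  "kb_valid1 L \<phi> \<longleftrightarrow> (\<forall>V1 V2. valuation L V1 V2 \<longrightarrow> (\<forall>g\<in>Obj L. kb_sat1 L V1 V2 g \<phi>))"

definition kb_valid2 :: "('g, 'm) ctxt \<Rightarrow> ('p, 'q) kb2 \<Rightarrow> bool" where
  "kb_valid2 L \<psi> \<longleftrightarrow> (\<forall>V1 V2. valuation L V1 V2 \<longrightarrow> (\<forall>m\<in>Att L. kb_sat2 L V1 V2 m \<psi>))"

definition kf_valid1 :: "('g, 'm) ctxt \<Rightarrow> ('p, 'q) kf1 \<Rightarrow> bool" where
  "kf_valid1 L \<phi> \<longleftrightarrow> (\<forall>V1 V2. valuation L V1 V2 \<longrightarrow> (\<forall>g\<in>Obj L. kf_sat1 L V1 V2 g \<phi>))"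

definition kf_valid2 :: "('g, 'm) ctxt \<Rightarrow> ('p, 'q) kf2 \<Rightarrow> bool" where
  "kf_valid2 L \<psi> \<longleftrightarrow> (\<forall>V1 V2. valuation L V1 V2 \<longrightarrow> (\<forall>m\<in>Att L. kf_sat2 L V1 V2 m \<psi>))"

definition Fm_PC :: "('g, 'm) ctxt \<Rightarrow> (('p, 'q) kb1 \<times> ('p, 'q) kb2) set" where
  "Fm_PC L = {(\<phi>, \<psi>).
     kb_valid1 L (KBIff1 (BoxInv (Dia \<phi>)) \<phi>) \<and> kb_valid2 L (KBIff2 (Dia (BoxInv \<psi>)) \<psi>) \<and>
     kb_valid1 L (KBIff1 \<phi> (BoxInv \<psi>)) \<and> kb_valid2 L (KBIff2 (Dia \<phi>) \<psi>)}"

definition Fm_OC :: "('g, 'm) ctxt \<Rightarrow> (('p, 'q) kb1 \<times> ('p, 'q) kb2) set" where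
  "Fm_OC L = {(\<phi>, \<psi>).
     kb_valid1 L (KBIff1 (DiaInv (Box \<phi>)) \<phi>) \<and> kb_valid2 L (KBIff2 (Box (DiaInv \<psi>)) \<psi>) \<and>
     kb_valid1 L (KBIff1 \<phi> (DiaInv \<psi>)) \<and> kb_valid2 L (KBIff2 (Box \<phi>) \<psi>)}"

definition Fm_FC :: "('g, 'm) ctxt \<Rightarrow> (('p, 'q) kf1 \<times> ('p, 'q) kf2) set" where
  "Fm_FC L = {(\<phi>, \<psi>).
     kf_valid1 L (KFIff1 (WinInv (Win \<phi>)) \<phi>) \<and> kf_valid2 L (KFIff2 (Win (WinInv \<psi>)) \<psi>) \<and>
     kf_valid1 L (KFIff1 \<phi> (WinInv \<psi>)) \<and> kf_valid2 L (KFIff2 (Win \<phi>) \<psi>)}"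

definition eq_PC :: "('g, 'm) ctxt \<Rightarrow> (('p, 'q) kb1 \<times> ('p, 'q) kb2) rel" where
  "eq_PC L = {(c, c'). c \<in> Fm_PC L \<and> c' \<in> Fm_PC L \<and> kb_valid1 L (KBIff1 (fst c) (fst c'))}"

definition eq_OC :: "('g, 'm) ctxt \<Rightarrow> (('p, 'q) kb1 \<times> ('p, 'q) kb2) rel" where
  "eq_OC L = {(c, c'). c \<in> Fm_OC L \<and> c' \<in> Fm_OC L \<and> kb_valid1 L (KBIff1 (fst c) (fst c'))}"

definition eq_FC :: "('g, 'm) ctxt \<Rightarrow> (('p, 'q) kf1 \<times> ('p, 'q) kf2) rel" where
  "eq_FC L = {(c, c'). c \<in> Fm_FC L \<and> c' \<in> Fm_FC L \<and> kf_valid1 L (KFIff1 (fst c) (fst c'))}"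

text \<open>Operations are lifted from representatives as in \<^theory>\<open>HOL.Equiv_Relations\<close>; that this is
  legitimate, so that \<open>[c] \<and> [c']\<close> is the class of the displayed pair, is proved below.\<close>

definition meet_FC where
  "meet_FC L X Y = (\<Union>(\<phi>, \<psi>)\<in>X. \<Union>(\<phi>', \<psi>')\<in>Y. eq_FC L `` {(KFAnd1 \<phi> \<phi>', Win (KFAnd1 \<phi> \<phi>'))})"

definition join_FC where
  "join_FC L X Y = (\<Union>(\<phi>, \<psi>)\<in>X. \<Union>(\<phi>', \<psi>')\<in>Y. eq_FC L `` {(WinInv (KFAnd2 \<psi> \<psi>'), KFAnd2 \<psi> \<psi>')})"

text \<open>Extents of property oriented concepts are closed under conjunction, but intents, being fixed
  points of the interior operator \<open>\<diamond>\<box>\<inverse>\<close>, are closed under disjunction. The join therefore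
  takes the disjunction of the intents. The variant \<open>(\<box>\<inverse>(\<psi> \<and> \<psi>'), \<psi> \<and> \<psi>')\<close>, which also appears
  in print, is not usable: the pair need not be a concept, and \<open>\<box>\<inverse>(\<psi> \<and> \<psi>')\<close> is equivalent to
  \<open>\<phi> \<and> \<phi>'\<close>, so that the join would collapse to the meet.\<close>

definition meet_PC where
  "meet_PC L X Y = (\<Union>(\<phi>, \<psi>)\<in>X. \<Union>(\<phi>', \<psi>')\<in>Y. eq_PC L `` {(KBAnd1 \<phi> \<phi>', Dia (KBAnd1 \<phi> \<phi>'))})"

definition join_PC where
  "join_PC L X Y = (\<Union>(\<phi>, \<psi>)\<in>X. \<Union>(\<phi>', \<psi>')\<in>Y. eq_PC L `` {(BoxInv (KBOr2 \<psi> \<psi>'), KBOr2 \<psi> \<psi>')})"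

text \<open>For object oriented concepts the extents, fixed points of the interior operator
  \<open>\<diamond>\<inverse>\<box>\<close>, are closed under disjunction, and the intents under conjunction. In the order by
  extent the pair built from \<open>\<psi> \<and> \<psi>'\<close> is the meet and the one built from \<open>\<phi> \<or> \<phi>'\<close> is the join.
  The variant printed with the former as join and \<open>(\<phi> \<and> \<phi>', \<box>(\<phi> \<and> \<phi>'))\<close> as meet is not usable,
  since the latter need not be a concept.\<close>

definition meet_OC where
  "meet_OC L X Y = (\<Union>(\<phi>, \<psi>)\<in>X. \<Union>(\<phi>', \<psi>')\<in>Y. eq_OC L `` {(DiaInv (KBAnd2 \<psi> \<psi>'), KBAnd2 \<psi> \<psi>')})"

definition join_OC where
  "join_OC L X Y = (\<Union>(\<phi>, \<psi>)\<in>X. \<Union>(\<phi>', \<psi>')\<in>Y. eq_OC L `` {(KBOr1 \<phi> \<phi>', Box (KBOr1 \<phi> \<phi>'))})"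

text \<open>Algebras are triples of carrier, join and meet.\<close>

type_synonym 'a alg = "'a set \<times> ('a \<Rightarrow> 'a \<Rightarrow> 'a) \<times> ('a \<Rightarrow> 'a \<Rightarrow> 'a)"

fun alg_isomorphic :: "'a alg \<Rightarrow> 'b alg \<Rightarrow> bool" where
  "alg_isomorphic (A, joinA, meetA) (B, joinB, meetB) \<longleftrightarrow>
     (\<exists>f. bij_betw f A B \<and>
       (\<forall>x\<in>A. \<forall>y\<in>A. f (joinA x y) = joinB (f x) (f y) \<and> f (meetA x y) = meetB (f x) (f y)))"

fun alg_dually_isomorphic :: "'a alg \<Rightarrow> 'b alg \<Rightarrow> bool" where
  "alg_dually_isomorphic (A, joinA, meetA) (B, joinB, meetB) \<longleftrightarrow>
     (\<exists>f. bij_betw f A B \<and>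
       (\<forall>x\<in>A. \<forall>y\<in>A. f (joinA x y) = meetB (f x) (f y) \<and> f (meetA x y) = joinB (f x) (f y)))"

definition FC_alg :: "('g, 'm) ctxt \<Rightarrow> (('p, 'q) kf1 \<times> ('p, 'q) kf2) set alg" where
  "FC_alg L = (Fm_FC L // eq_FC L, join_FC L, meet_FC L)"

definition PC_alg :: "('g, 'm) ctxt \<Rightarrow> (('p, 'q) kb1 \<times> ('p, 'q) kb2) set alg" where
  "PC_alg L = (Fm_PC L // eq_PC L, join_PC L, meet_PC L)"

definition OC_alg :: "('g, 'm) ctxt \<Rightarrow> (('p, 'q) kb1 \<times> ('p, 'q) kb2) set alg" where
  "OC_alg L = (Fm_OC L // eq_OC L, join_OC L, meet_OC L)"

lemma iff_unfold: "\<not> (a \<and> \<not> b) \<and> \<not> (b \<and> \<not> a) \<longleftrightarrow> a = b"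
  by argo

lemma kb_valid1_iff: "kb_valid1 L (KBIff1 \<phi> \<phi>') \<longleftrightarrow> (\<forall>V1 V2. valuation L V1 V2 \<longrightarrow>
    (\<forall>g\<in>Obj L. kb_sat1 L V1 V2 g \<phi> = kb_sat1 L V1 V2 g \<phi>'))"
  unfolding kb_valid1_def kb_sat1.simps iff_unfold by (rule refl)

lemma kb_valid2_iff: "kb_valid2 L (KBIff2 \<psi> \<psi>') \<longleftrightarrow> (\<forall>V1 V2. valuation L V1 V2 \<longrightarrow>
    (\<forall>m\<in>Att L. kb_sat2 L V1 V2 m \<psi> = kb_sat2 L V1 V2 m \<psi>'))"
  unfolding kb_valid2_def kb_sat2.simps iff_unfold by (rule refl)

lemma kf_valid1_iff: "kf_valid1 L (KFIff1 \<phi> \<phi>') \<longleftrightarrow> (\<forall>V1 V2. valuation L V1 V2 \<longrightarrow>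
    (\<forall>g\<in>Obj L. kf_sat1 L V1 V2 g \<phi> = kf_sat1 L V1 V2 g \<phi>'))"
  unfolding kf_valid1_def kf_sat1.simps iff_unfold by (rule refl)

lemma kf_valid2_iff: "kf_valid2 L (KFIff2 \<psi> \<psi>') \<longleftrightarrow> (\<forall>V1 V2. valuation L V1 V2 \<longrightarrow>
    (\<forall>m\<in>Att L. kf_sat2 L V1 V2 m \<psi> = kf_sat2 L V1 V2 m \<psi>'))"
  unfolding kf_valid2_def kf_sat2.simps iff_unfold by (rule refl)

lemmas valid_iff = kb_valid1_iff kb_valid2_iff kf_valid1_iff kf_valid2_iff

lemma in_FC_iff:
  "(\<phi>, \<psi>) \<in> Fm_FC L \<longleftrightarrow> (\<forall>V1 V2. valuation L V1 V2 \<longrightarrow>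
     (\<forall>g\<in>Obj L. kf_sat1 L V1 V2 g \<phi> \<longleftrightarrow> kf_sat1 L V1 V2 g (WinInv \<psi>)) \<and>
     (\<forall>m\<in>Att L. kf_sat2 L V1 V2 m \<psi> \<longleftrightarrow> kf_sat2 L V1 V2 m (Win \<phi>)))"
  (is "?l \<longleftrightarrow> ?r")
proof
  assume ?l
  then show ?r unfolding Fm_FC_def valid_iff mem_Collect_eq prod.case by blast
next
  assume r: ?r
  have "(\<forall>g\<in>Obj L. kf_sat1 L V1 V2 g (WinInv (Win \<phi>)) = kf_sat1 L V1 V2 g \<phi>) \<and>
        (\<forall>m\<in>Att L. kf_sat2 L V1 V2 m (Win (WinInv \<psi>)) = kf_sat2 L V1 V2 m \<psi>)"
    if "valuation L V1 V2" for V1 V2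
  proof -
    note r' = r[THEN spec, THEN spec, THEN mp, OF that]
    show ?thesis
      using r' unfolding kf_sat1.simps(4) kf_sat2.simps(4) by (intro conjI ballI) metis+
  qed
  with r show ?l unfolding Fm_FC_def valid_iff mem_Collect_eq prod.case by blast
qed

lemma in_PC_iff:
  "(\<phi>, \<psi>) \<in> Fm_PC L \<longleftrightarrow> (\<forall>V1 V2. valuation L V1 V2 \<longrightarrow>
     (\<forall>g\<in>Obj L. kb_sat1 L V1 V2 g \<phi> \<longleftrightarrow> kb_sat1 L V1 V2 g (BoxInv \<psi>)) \<and>
     (\<forall>m\<in>Att L. kb_sat2 L V1 V2 m \<psi> \<longleftrightarrow> kb_sat2 L V1 V2 m (Dia \<phi>)))"
  (is "?l \<longleftrightarrow> ?r")
proof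
  assume ?l
  then show ?r unfolding Fm_PC_def valid_iff mem_Collect_eq prod.case by blast
next
  assume r: ?r
  have "(\<forall>g\<in>Obj L. kb_sat1 L V1 V2 g (BoxInv (Dia \<phi>)) = kb_sat1 L V1 V2 g \<phi>) \<and>
        (\<forall>m\<in>Att L. kb_sat2 L V1 V2 m (Dia (BoxInv \<psi>)) = kb_sat2 L V1 V2 m \<psi>)"
    if "valuation L V1 V2" for V1 V2
  proof -
    note r' = r[THEN spec, THEN spec, THEN mp, OF that]
    show ?thesis
      using r' unfolding kb_sat1.simps(5) kb_sat2.simps(4) by (intro conjI ballI) metis+
  qed
  with r show ?l unfolding Fm_PC_def valid_iff mem_Collect_eq prod.case by blast
qed

lemma in_OC_iff:
  "(\<phi>, \<psi>) \<in> Fm_OC L \<longleftrightarrow> (\<forall>V1 V2. valuation L V1 V2 \<longrightarrow>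
     (\<forall>g\<in>Obj L. kb_sat1 L V1 V2 g \<phi> \<longleftrightarrow> kb_sat1 L V1 V2 g (DiaInv \<psi>)) \<and>
     (\<forall>m\<in>Att L. kb_sat2 L V1 V2 m \<psi> \<longleftrightarrow> kb_sat2 L V1 V2 m (Box \<phi>)))"
  (is "?l \<longleftrightarrow> ?r")
proof
  assume ?l
  then show ?r unfolding Fm_OC_def valid_iff mem_Collect_eq prod.case by blast
next
  assume r: ?r
  have "(\<forall>g\<in>Obj L. kb_sat1 L V1 V2 g (DiaInv (Box \<phi>)) = kb_sat1 L V1 V2 g \<phi>) \<and>
        (\<forall>m\<in>Att L. kb_sat2 L V1 V2 m (Box (DiaInv \<psi>)) = kb_sat2 L V1 V2 m \<psi>)"
    if "valuation L V1 V2" for V1 V2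
  proof -
    note r' = r[THEN spec, THEN spec, THEN mp, OF that]
    show ?thesis
      using r' unfolding kb_sat1.simps(4) kb_sat2.simps(5) by (intro conjI ballI) metis+
  qed
  with r show ?l unfolding Fm_OC_def valid_iff mem_Collect_eq prod.case by blast
qed

lemma equiv_FC: "equiv (Fm_FC L) (eq_FC L)"
  by (rule equivI) (auto simp: eq_FC_def valid_iff refl_on_def sym_def trans_def)

lemma equiv_PC: "equiv (Fm_PC L) (eq_PC L)"
  by (rule equivI) (auto simp: eq_PC_def valid_iff refl_on_def sym_def trans_def)

lemma equiv_OC: "equiv (Fm_OC L) (eq_OC L)"
  by (rule equivI) (auto simp: eq_OC_def valid_iff refl_on_def sym_def trans_def)

lemma in_eq_FC_iff:
  "((\<phi>, \<psi>), (\<phi>', \<psi>')) \<in> eq_FC L \<longleftrightarrow> (\<phi>, \<psi>) \<in> Fm_FC L \<and> (\<phi>', \<psi>') \<in> Fm_FC L \<and>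
    (\<forall>V1 V2. valuation L V1 V2 \<longrightarrow>
      (\<forall>g\<in>Obj L. kf_sat1 L V1 V2 g \<phi> = kf_sat1 L V1 V2 g \<phi>') \<and>
      (\<forall>m\<in>Att L. kf_sat2 L V1 V2 m \<psi> = kf_sat2 L V1 V2 m \<psi>'))"
  (is "?l \<longleftrightarrow> ?r")
proof
  assume l: ?l
  then have c: "(\<phi>, \<psi>) \<in> Fm_FC L" "(\<phi>', \<psi>') \<in> Fm_FC L"
    and e: "kf_valid1 L (KFIff1 \<phi> \<phi>')" by (simp_all add: eq_FC_def)
  have "(\<forall>g\<in>Obj L. kf_sat1 L V1 V2 g \<phi> = kf_sat1 L V1 V2 g \<phi>') \<and>
        (\<forall>m\<in>Att L. kf_sat2 L V1 V2 m \<psi> = kf_sat2 L V1 V2 m \<psi>')"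
    if "valuation L V1 V2" for V1 V2
  proof -
    have "\<forall>g\<in>Obj L. kf_sat1 L V1 V2 g \<phi> = kf_sat1 L V1 V2 g \<phi>'"
      using e that unfolding valid_iff by blast
    moreover have "\<forall>m\<in>Att L. kf_sat2 L V1 V2 m \<psi> = kf_sat2 L V1 V2 m (Win \<phi>)"
      "\<forall>m\<in>Att L. kf_sat2 L V1 V2 m \<psi>' = kf_sat2 L V1 V2 m (Win \<phi>')"
      using c that unfolding in_FC_iff by blast+
    ultimately show ?thesis by simp
  qed
  with c show ?r by blast
next
  assume ?r
  then show ?l unfolding eq_FC_def valid_iff mem_Collect_eq prod.case fst_conv by blast
qed

lemma in_eq_PC_iff:
  "((\<phi>, \<psi>), (\<phi>', \<psi>')) \<in> eq_PC L \<longleftrightarrow> (\<phi>, \<psi>) \<in> Fm_PC L \<and> (\<phi>', \<psi>') \<in> Fm_PC L \<and>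
    (\<forall>V1 V2. valuation L V1 V2 \<longrightarrow>
      (\<forall>g\<in>Obj L. kb_sat1 L V1 V2 g \<phi> = kb_sat1 L V1 V2 g \<phi>') \<and>
      (\<forall>m\<in>Att L. kb_sat2 L V1 V2 m \<psi> = kb_sat2 L V1 V2 m \<psi>'))"
  (is "?l \<longleftrightarrow> ?r")
proof
  assume l: ?l
  then have c: "(\<phi>, \<psi>) \<in> Fm_PC L" "(\<phi>', \<psi>') \<in> Fm_PC L"
    and e: "kb_valid1 L (KBIff1 \<phi> \<phi>')" by (simp_all add: eq_PC_def)
  have "(\<forall>g\<in>Obj L. kb_sat1 L V1 V2 g \<phi> = kb_sat1 L V1 V2 g \<phi>') \<and>
        (\<forall>m\<in>Att L. kb_sat2 L V1 V2 m \<psi> = kb_sat2 L V1 V2 m \<psi>')"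
    if "valuation L V1 V2" for V1 V2
  proof -
    have "\<forall>g\<in>Obj L. kb_sat1 L V1 V2 g \<phi> = kb_sat1 L V1 V2 g \<phi>'"
      using e that unfolding valid_iff by blast
    moreover have "\<forall>m\<in>Att L. kb_sat2 L V1 V2 m \<psi> = kb_sat2 L V1 V2 m (Dia \<phi>)"
      "\<forall>m\<in>Att L. kb_sat2 L V1 V2 m \<psi>' = kb_sat2 L V1 V2 m (Dia \<phi>')"
      using c that unfolding in_PC_iff by blast+
    ultimately show ?thesis by simp
  qed
  with c show ?r by blast
next
  assume ?r
  then show ?l unfolding eq_PC_def valid_iff mem_Collect_eq prod.case fst_conv by blast
qed

lemma in_eq_OC_iff:
  "((\<phi>, \<psi>), (\<phi>', \<psi>')) \<in> eq_OC L \<longleftrightarrow> (\<phi>, \<psi>) \<in> Fm_OC L \<and> (\<phi>', \<psi>') \<in> Fm_OC L \<and>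
    (\<forall>V1 V2. valuation L V1 V2 \<longrightarrow>
      (\<forall>g\<in>Obj L. kb_sat1 L V1 V2 g \<phi> = kb_sat1 L V1 V2 g \<phi>') \<and>
      (\<forall>m\<in>Att L. kb_sat2 L V1 V2 m \<psi> = kb_sat2 L V1 V2 m \<psi>'))"
  (is "?l \<longleftrightarrow> ?r")
proof
  assume l: ?l
  then have c: "(\<phi>, \<psi>) \<in> Fm_OC L" "(\<phi>', \<psi>') \<in> Fm_OC L"
    and e: "kb_valid1 L (KBIff1 \<phi> \<phi>')" by (simp_all add: eq_OC_def)
  have "(\<forall>g\<in>Obj L. kb_sat1 L V1 V2 g \<phi> = kb_sat1 L V1 V2 g \<phi>') \<and>
        (\<forall>m\<in>Att L. kb_sat2 L V1 V2 m \<psi> = kb_sat2 L V1 V2 m \<psi>')"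
    if "valuation L V1 V2" for V1 V2
  proof -
    have "\<forall>g\<in>Obj L. kb_sat1 L V1 V2 g \<phi> = kb_sat1 L V1 V2 g \<phi>'"
      using e that unfolding valid_iff by blast
    moreover have "\<forall>m\<in>Att L. kb_sat2 L V1 V2 m \<psi> = kb_sat2 L V1 V2 m (Box \<phi>)"
      "\<forall>m\<in>Att L. kb_sat2 L V1 V2 m \<psi>' = kb_sat2 L V1 V2 m (Box \<phi>')"
      using c that unfolding in_OC_iff by blast+
    ultimately show ?thesis by simp
  qed
  with c show ?r by blast
next
  assume ?r
  then show ?l unfolding eq_OC_def valid_iff mem_Collect_eq prod.case fst_conv by blast
qed

lemma meet_FC_closed:
  assumes "(\<phi>, \<psi>) \<in> Fm_FC L" "(\<phi>', \<psi>') \<in> Fm_FC L"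
  shows "(KFAnd1 \<phi> \<phi>', Win (KFAnd1 \<phi> \<phi>')) \<in> Fm_FC L"
    (is "(?e, ?i) \<in> _")
proof -
  have "(\<forall>g\<in>Obj L. kf_sat1 L V1 V2 g ?e \<longleftrightarrow> kf_sat1 L V1 V2 g (WinInv ?i)) \<and>
        (\<forall>m\<in>Att L. kf_sat2 L V1 V2 m ?i \<longleftrightarrow> kf_sat2 L V1 V2 m (Win ?e))"
    if "valuation L V1 V2" for V1 V2
    using assms[unfolded in_FC_iff, THEN spec, THEN spec, THEN mp, OF that] unfolding kf_sat1.simps kf_sat2.simps
    by (intro conjI ballI; (rule refl | meson))
  then show ?thesis unfolding in_FC_iff by iprover
qed

lemma join_FC_closed:
  assumes "(\<phi>, \<psi>) \<in> Fm_FC L" "(\<phi>', \<psi>') \<in> Fm_FC L"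
  shows "(WinInv (KFAnd2 \<psi> \<psi>'), KFAnd2 \<psi> \<psi>') \<in> Fm_FC L"
    (is "(?e, ?i) \<in> _")
proof -
  have "(\<forall>g\<in>Obj L. kf_sat1 L V1 V2 g ?e \<longleftrightarrow> kf_sat1 L V1 V2 g (WinInv ?i)) \<and>
        (\<forall>m\<in>Att L. kf_sat2 L V1 V2 m ?i \<longleftrightarrow> kf_sat2 L V1 V2 m (Win ?e))"
    if "valuation L V1 V2" for V1 V2
    using assms[unfolded in_FC_iff, THEN spec, THEN spec, THEN mp, OF that] unfolding kf_sat1.simps kf_sat2.simps
    by (intro conjI ballI; (rule refl | meson))
  then show ?thesis unfolding in_FC_iff by iprover
qed

lemma meet_PC_closed:
  assumes "(\<phi>, \<psi>) \<in> Fm_PC L" "(\<phi>', \<psi>') \<in> Fm_PC L"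
  shows "(KBAnd1 \<phi> \<phi>', Dia (KBAnd1 \<phi> \<phi>')) \<in> Fm_PC L"
    (is "(?e, ?i) \<in> _")
proof -
  have "(\<forall>g\<in>Obj L. kb_sat1 L V1 V2 g ?e \<longleftrightarrow> kb_sat1 L V1 V2 g (BoxInv ?i)) \<and>
        (\<forall>m\<in>Att L. kb_sat2 L V1 V2 m ?i \<longleftrightarrow> kb_sat2 L V1 V2 m (Dia ?e))"
    if "valuation L V1 V2" for V1 V2
    using assms[unfolded in_PC_iff, THEN spec, THEN spec, THEN mp, OF that] unfolding kb_sat1.simps kb_sat2.simps
    by (intro conjI ballI; (rule refl | meson))
  then show ?thesis unfolding in_PC_iff by iprover
qed

lemma join_PC_closed:
  assumes "(\<phi>, \<psi>) \<in> Fm_PC L" "(\<phi>', \<psi>') \<in> Fm_PC L"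
  shows "(BoxInv (KBOr2 \<psi> \<psi>'), KBOr2 \<psi> \<psi>') \<in> Fm_PC L"
    (is "(?e, ?i) \<in> _")
proof -
  have "(\<forall>g\<in>Obj L. kb_sat1 L V1 V2 g ?e \<longleftrightarrow> kb_sat1 L V1 V2 g (BoxInv ?i)) \<and>
        (\<forall>m\<in>Att L. kb_sat2 L V1 V2 m ?i \<longleftrightarrow> kb_sat2 L V1 V2 m (Dia ?e))"
    if "valuation L V1 V2" for V1 V2
    using assms[unfolded in_PC_iff, THEN spec, THEN spec, THEN mp, OF that] unfolding kb_sat1.simps kb_sat2.simps
    by (intro conjI ballI; (rule refl | meson))
  then show ?thesis unfolding in_PC_iff by iprover
qed

lemma meet_OC_closed:
  assumes "(\<phi>, \<psi>) \<in> Fm_OC L" "(\<phi>', \<psi>') \<in> Fm_OC L"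
  shows "(DiaInv (KBAnd2 \<psi> \<psi>'), KBAnd2 \<psi> \<psi>') \<in> Fm_OC L"
    (is "(?e, ?i) \<in> _")
proof -
  have "(\<forall>g\<in>Obj L. kb_sat1 L V1 V2 g ?e \<longleftrightarrow> kb_sat1 L V1 V2 g (DiaInv ?i)) \<and>
        (\<forall>m\<in>Att L. kb_sat2 L V1 V2 m ?i \<longleftrightarrow> kb_sat2 L V1 V2 m (Box ?e))"
    if "valuation L V1 V2" for V1 V2
    using assms[unfolded in_OC_iff, THEN spec, THEN spec, THEN mp, OF that] unfolding kb_sat1.simps kb_sat2.simps
    by (intro conjI ballI; (rule refl | meson))
  then show ?thesis unfolding in_OC_iff by iprover
qed

lemma join_OC_closed:
  assumes "(\<phi>, \<psi>) \<in> Fm_OC L" "(\<phi>', \<psi>') \<in> Fm_OC L"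
  shows "(KBOr1 \<phi> \<phi>', Box (KBOr1 \<phi> \<phi>')) \<in> Fm_OC L"
    (is "(?e, ?i) \<in> _")
proof -
  have "(\<forall>g\<in>Obj L. kb_sat1 L V1 V2 g ?e \<longleftrightarrow> kb_sat1 L V1 V2 g (DiaInv ?i)) \<and>
        (\<forall>m\<in>Att L. kb_sat2 L V1 V2 m ?i \<longleftrightarrow> kb_sat2 L V1 V2 m (Box ?e))"
    if "valuation L V1 V2" for V1 V2
    using assms[unfolded in_OC_iff, THEN spec, THEN spec, THEN mp, OF that] unfolding kb_sat1.simps kb_sat2.simps
    by (intro conjI ballI; (rule refl | meson))
  then show ?thesis unfolding in_OC_iff by iprover
qed

lemma UN_UN_class:
  assumes "equiv A r" "(\<phi>, \<psi>) \<in> A" "(\<phi>', \<psi>') \<in> A"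
    and "\<And>a b c d a' b' c' d'. ((a, b), (a', b')) \<in> r \<Longrightarrow> ((c, d), (c', d')) \<in> r \<Longrightarrow>
           (h a b c d, h a' b' c' d') \<in> r"
  shows "(\<Union>(a, b)\<in>r `` {(\<phi>, \<psi>)}. \<Union>(c, d)\<in>r `` {(\<phi>', \<psi>')}. r `` {h a b c d})
       = r `` {h \<phi> \<psi> \<phi>' \<psi>'}"
proof -
  let ?f = "\<lambda>x y. case x of (a, b) \<Rightarrow> case y of (c, d) \<Rightarrow> r `` {h a b c d}"
  have "congruent2 r r ?f"
  proof (rule congruent2I')
    fix x x' y y' assume "(x, x') \<in> r" "(y, y') \<in> r"
    then show "?f x y = ?f x' y'"
      using equiv_class_eq[OF assms(1) assms(4)] by (cases x; cases x'; cases y; cases y') simp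
  qed
  from UN_equiv_class2[OF assms(1,1) this assms(2,3)] show ?thesis
    by (simp add: split_def)
qed

lemma meet_FC_class:
  assumes "(\<phi>, \<psi>) \<in> Fm_FC L" "(\<phi>', \<psi>') \<in> Fm_FC L"
  shows "meet_FC L (eq_FC L `` {(\<phi>, \<psi>)}) (eq_FC L `` {(\<phi>', \<psi>')})
       = eq_FC L `` {(KFAnd1 \<phi> \<phi>', Win (KFAnd1 \<phi> \<phi>'))}"
  unfolding meet_FC_def
  by (rule UN_UN_class[OF equiv_FC assms]) (auto simp: in_eq_FC_iff meet_FC_closed)

lemma join_FC_class:
  assumes "(\<phi>, \<psi>) \<in> Fm_FC L" "(\<phi>', \<psi>') \<in> Fm_FC L"
  shows "join_FC L (eq_FC L `` {(\<phi>, \<psi>)}) (eq_FC L `` {(\<phi>', \<psi>')})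
       = eq_FC L `` {(WinInv (KFAnd2 \<psi> \<psi>'), KFAnd2 \<psi> \<psi>')}"
  unfolding join_FC_def
  by (rule UN_UN_class[OF equiv_FC assms]) (auto simp: in_eq_FC_iff join_FC_closed)

lemma meet_PC_class:
  assumes "(\<phi>, \<psi>) \<in> Fm_PC L" "(\<phi>', \<psi>') \<in> Fm_PC L"
  shows "meet_PC L (eq_PC L `` {(\<phi>, \<psi>)}) (eq_PC L `` {(\<phi>', \<psi>')})
       = eq_PC L `` {(KBAnd1 \<phi> \<phi>', Dia (KBAnd1 \<phi> \<phi>'))}"
  unfolding meet_PC_def
  by (rule UN_UN_class[OF equiv_PC assms]) (auto simp: in_eq_PC_iff meet_PC_closed)

lemma join_PC_class:
  assumes "(\<phi>, \<psi>) \<in> Fm_PC L" "(\<phi>', \<psi>') \<in> Fm_PC L"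
  shows "join_PC L (eq_PC L `` {(\<phi>, \<psi>)}) (eq_PC L `` {(\<phi>', \<psi>')})
       = eq_PC L `` {(BoxInv (KBOr2 \<psi> \<psi>'), KBOr2 \<psi> \<psi>')}"
  unfolding join_PC_def
  by (rule UN_UN_class[OF equiv_PC assms]) (auto simp: in_eq_PC_iff join_PC_closed)

lemma meet_OC_class:
  assumes "(\<phi>, \<psi>) \<in> Fm_OC L" "(\<phi>', \<psi>') \<in> Fm_OC L"
  shows "meet_OC L (eq_OC L `` {(\<phi>, \<psi>)}) (eq_OC L `` {(\<phi>', \<psi>')})
       = eq_OC L `` {(DiaInv (KBAnd2 \<psi> \<psi>'), KBAnd2 \<psi> \<psi>')}"
  unfolding meet_OC_def
  by (rule UN_UN_class[OF equiv_OC assms]) (auto simp: in_eq_OC_iff meet_OC_closed)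

lemma join_OC_class:
  assumes "(\<phi>, \<psi>) \<in> Fm_OC L" "(\<phi>', \<psi>') \<in> Fm_OC L"
  shows "join_OC L (eq_OC L `` {(\<phi>, \<psi>)}) (eq_OC L `` {(\<phi>', \<psi>')})
       = eq_OC L `` {(KBOr1 \<phi> \<phi>', Box (KBOr1 \<phi> \<phi>'))}"
  unfolding join_OC_def
  by (rule UN_UN_class[OF equiv_OC assms]) (auto simp: in_eq_OC_iff join_OC_closed)

end

theory Submission
  imports Defs
begin

text \<open>A window modality over \<open>I\<close> is a box over \<open>I\<^sup>c\<close> applied to a negation, so each of the two
  languages translates into the other with the same truth value at every world. Under the
  translation, \<open>(\<phi>, \<psi>) \<mapsto> (\<phi>, \<not> \<psi>)\<close> carries formal concepts of \<open>K\<close> to property oriented concepts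
  of its complement, and \<open>(\<phi>, \<psi>) \<mapsto> (\<not> \<phi>, \<not> \<psi>)\<close> carries the latter to object oriented concepts with
  the order by extent reversed. Both maps are invertible up to logical equivalence.\<close>

section \<open>Isomorphisms of quotient algebras induced by maps on representatives\<close>

text \<open>Since \<open>f\<close> and \<open>g\<close> respect the relations, they descend to maps
  on classes, and these are mutually inverse because \<open>g (f x)\<close> and
  \<open>f (g y)\<close> return to their starting class. Operations on classes are computed by
  \<open>jA\<close>, \<open>mA\<close>, \<open>jB\<close>, \<open>mB\<close> on representatives, so
  \<open>f\<close> has to commute with those only up to \<open>s\<close>.\<close>

lemma quotient_alg_isomorphic:
  assumes r: "equiv A r" and s: "equiv B s"
    and f: "\<And>x y. (x, y) \<in> r \<Longrightarrow> (f x, f y) \<in> s"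
    and g: "\<And>x y. (x, y) \<in> s \<Longrightarrow> (g x, g y) \<in> r"
    and gf: "\<And>x. x \<in> A \<Longrightarrow> (g (f x), x) \<in> r"
    and fg: "\<And>y. y \<in> B \<Longrightarrow> (f (g y), y) \<in> s"
    and joinA: "\<And>x y. x \<in> A \<Longrightarrow> y \<in> A \<Longrightarrow> joinA (r `` {x}) (r `` {y}) = r `` {jA x y}"
    and meetA: "\<And>x y. x \<in> A \<Longrightarrow> y \<in> A \<Longrightarrow> meetA (r `` {x}) (r `` {y}) = r `` {mA x y}"
    and joinB: "\<And>x y. x \<in> B \<Longrightarrow> y \<in> B \<Longrightarrow> joinB (s `` {x}) (s `` {y}) = s `` {jB x y}"
    and meetB: "\<And>x y. x \<in> B \<Longrightarrow> y \<in> B \<Longrightarrow> meetB (s `` {x}) (s `` {y}) = s `` {mB x y}"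
    and jA: "\<And>x y. x \<in> A \<Longrightarrow> y \<in> A \<Longrightarrow> jA x y \<in> A"
    and mA: "\<And>x y. x \<in> A \<Longrightarrow> y \<in> A \<Longrightarrow> mA x y \<in> A"
    and join: "\<And>x y. x \<in> A \<Longrightarrow> y \<in> A \<Longrightarrow> (f (jA x y), jB (f x) (f y)) \<in> s"
    and meet: "\<And>x y. x \<in> A \<Longrightarrow> y \<in> A \<Longrightarrow> (f (mA x y), mB (f x) (f y)) \<in> s"
  shows "alg_isomorphic (A // r, joinA, meetA) (B // s, joinB, meetB)"
proof -
  \<comment> \<open>A map that respects the relations also maps carrier to carrier: apply it to the
    reflexive pair \<open>(x, x)\<close>.\<close>
  have fB: "f x \<in> B" if "x \<in> A" for x
    using f[of x x] that r s by (auto simp: equiv_def refl_on_def)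
  have gA: "g y \<in> A" if "y \<in> B" for y
    using g[of y y] that r s by (auto simp: equiv_def refl_on_def)
  \<comment> \<open>Taking a union avoids choosing a representative: all members of a class
    contribute the same class of \<open>s\<close>, so the union collapses to it.\<close>
  define F where "F X = (\<Union>x\<in>X. s `` {f x})" for X
  define H where "H Y = (\<Union>y\<in>Y. r `` {g y})" for Y
  have F: "F (r `` {x}) = s `` {f x}" if "x \<in> A" for x
    unfolding F_def by (rule UN_equiv_class[OF r _ that])
      (auto simp: congruent_def intro!: equiv_class_eq[OF s] f)
  have H: "H (s `` {y}) = r `` {g y}" if "y \<in> B" for y
    unfolding H_def by (rule UN_equiv_class[OF s _ that])
      (auto simp: congruent_def intro!: equiv_class_eq[OF r] g)
  have "bij_betw F (A // r) (B // s)"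
  proof (rule bij_betw_byWitness[where f' = H])
    show "\<forall>X\<in>A // r. H (F X) = X"
      by (auto elim!: quotientE simp: F H fB equiv_class_eq[OF r gf])
    show "\<forall>Y\<in>B // s. F (H Y) = Y"
      by (auto elim!: quotientE simp: F H gA equiv_class_eq[OF s fg])
    show "F ` (A // r) \<subseteq> B // s"
      by (auto elim!: quotientE simp: F fB intro!: quotientI)
    show "H ` (B // s) \<subseteq> A // r"
      by (auto elim!: quotientE simp: H gA intro!: quotientI)
  qed
  moreover have "F (joinA X Y) = joinB (F X) (F Y) \<and> F (meetA X Y) = meetB (F X) (F Y)"
    if "X \<in> A // r" "Y \<in> A // r" for X Y
    using that by (auto elim!: quotientE simp: F fB joinA meetA joinB meetB jA mA
        equiv_class_eq[OF s join] equiv_class_eq[OF s meet])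
  ultimately show ?thesis
    by auto
qed

text \<open>Swapping the operations of the target turns dual isomorphisms into isomorphisms, so the
  criterion above and composition cover them as well.\<close>

lemma alg_dually_isomorphic_iff:
  "alg_dually_isomorphic (A, joinA, meetA) (B, joinB, meetB) \<longleftrightarrow>
   alg_isomorphic (A, joinA, meetA) (B, meetB, joinB)"
  by simp

lemma alg_isomorphic_trans:
  assumes "alg_isomorphic (A, joinA, meetA) (B, joinB, meetB)"
    and "alg_isomorphic (B, joinB, meetB) (C, joinC, meetC)"
  shows "alg_isomorphic (A, joinA, meetA) (C, joinC, meetC)"
proof -
  obtain f where f: "bij_betw f A B" and f_hom: "\<forall>x\<in>A. \<forall>y\<in>A.
      f (joinA x y) = joinB (f x) (f y) \<and> f (meetA x y) = meetB (f x) (f y)"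
    using assms(1) by auto
  obtain g where g: "bij_betw g B C" and g_hom: "\<forall>x\<in>B. \<forall>y\<in>B.
      g (joinB x y) = joinC (g x) (g y) \<and> g (meetB x y) = meetC (g x) (g y)"
    using assms(2) by auto
  have "f x \<in> B" if "x \<in> A" for x
    using f that by (rule bij_betw_apply)
  then show ?thesis
    using bij_betw_trans[OF f g] f_hom g_hom by (auto intro!: exI[of _ "g \<circ> f"])
qed

section \<open>Translations between the window language and the box language\<close>

primrec kb_of_kf1 :: "('p, 'q) kf1 \<Rightarrow> ('p, 'q) kb1"
  and kb_of_kf2 :: "('p, 'q) kf2 \<Rightarrow> ('p, 'q) kb2" where
  "kb_of_kf1 (KFVar1 p) = KBVar1 p"
| "kb_of_kf1 (KFNeg1 \<phi>) = KBNeg1 (kb_of_kf1 \<phi>)"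
| "kb_of_kf1 (KFAnd1 \<phi> \<phi>') = KBAnd1 (kb_of_kf1 \<phi>) (kb_of_kf1 \<phi>')"
| "kb_of_kf1 (WinInv \<psi>) = BoxInv (KBNeg2 (kb_of_kf2 \<psi>))"
| "kb_of_kf2 (KFVar2 q) = KBVar2 q"
| "kb_of_kf2 (KFNeg2 \<psi>) = KBNeg2 (kb_of_kf2 \<psi>)"
| "kb_of_kf2 (KFAnd2 \<psi> \<psi>') = KBAnd2 (kb_of_kf2 \<psi>) (kb_of_kf2 \<psi>')"
| "kb_of_kf2 (Win \<phi>) = Box (KBNeg1 (kb_of_kf1 \<phi>))"

text \<open>A diamond over the complement asserts a witness outside the incidence relation, which is
  exactly the failure of a window; hence the negated windows.\<close>

primrec kf_of_kb1 :: "('p, 'q) kb1 \<Rightarrow> ('p, 'q) kf1"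
  and kf_of_kb2 :: "('p, 'q) kb2 \<Rightarrow> ('p, 'q) kf2" where
  "kf_of_kb1 (KBVar1 p) = KFVar1 p"
| "kf_of_kb1 (KBNeg1 \<phi>) = KFNeg1 (kf_of_kb1 \<phi>)"
| "kf_of_kb1 (KBAnd1 \<phi> \<phi>') = KFAnd1 (kf_of_kb1 \<phi>) (kf_of_kb1 \<phi>')"
| "kf_of_kb1 (DiaInv \<psi>) = KFNeg1 (WinInv (kf_of_kb2 \<psi>))"
| "kf_of_kb1 (BoxInv \<psi>) = WinInv (KFNeg2 (kf_of_kb2 \<psi>))"
| "kf_of_kb2 (KBVar2 q) = KFVar2 q"
| "kf_of_kb2 (KBNeg2 \<psi>) = KFNeg2 (kf_of_kb2 \<psi>)"
| "kf_of_kb2 (KBAnd2 \<psi> \<psi>') = KFAnd2 (kf_of_kb2 \<psi>) (kf_of_kb2 \<psi>')"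
| "kf_of_kb2 (Dia \<phi>) = KFNeg2 (Win (kf_of_kb1 \<phi>))"
| "kf_of_kb2 (Box \<phi>) = Win (KFNeg1 (kf_of_kb1 \<phi>))"

lemma compl_context_simps [simp]:
  "Obj (compl_context K) = Obj K" "Att (compl_context K) = Att K"
  "Inc (compl_context K) = Obj K \<times> Att K - Inc K"
  by (simp_all add: compl_context_def)

lemma valuation_compl [simp]: "valuation (compl_context K) V1 V2 \<longleftrightarrow> valuation K V1 V2"
  by (simp add: valuation_def)

text \<open>The modal cases are contraposition: "\<psi> implies incidence" against "non-incidence
  implies not \<psi>". Worlds are restricted to objects and attributes because only there does
  non-incidence in \<open>K\<close> amount to incidence in \<open>compl_context K\<close>.\<close>

lemma kb_of_kf_sat:
  shows kb_of_kf1_sat: "g \<in> Obj K \<Longrightarrow>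
      kb_sat1 (compl_context K) V1 V2 g (kb_of_kf1 \<phi>) \<longleftrightarrow> kf_sat1 K V1 V2 g \<phi>"
    and kb_of_kf2_sat: "m \<in> Att K \<Longrightarrow>
      kb_sat2 (compl_context K) V1 V2 m (kb_of_kf2 \<psi>) \<longleftrightarrow> kf_sat2 K V1 V2 m \<psi>"
  by (induction \<phi> and \<psi> arbitrary: g and m) auto

lemma kf_of_kb_sat:
  shows kf_of_kb1_sat: "g \<in> Obj K \<Longrightarrow>
      kf_sat1 K V1 V2 g (kf_of_kb1 \<phi>) \<longleftrightarrow> kb_sat1 (compl_context K) V1 V2 g \<phi>"
    and kf_of_kb2_sat: "m \<in> Att K \<Longrightarrow>
      kf_sat2 K V1 V2 m (kf_of_kb2 \<psi>) \<longleftrightarrow> kb_sat2 (compl_context K) V1 V2 m \<psi>"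
  by (induction \<phi> and \<psi> arbitrary: g and m) auto

section \<open>Maps between the three kinds of concepts\<close>

definition PC_of_FC :: "('p, 'q) kf1 \<times> ('p, 'q) kf2 \<Rightarrow> ('p, 'q) kb1 \<times> ('p, 'q) kb2" where
  "PC_of_FC = (\<lambda>(\<phi>, \<psi>). (kb_of_kf1 \<phi>, KBNeg2 (kb_of_kf2 \<psi>)))"

definition FC_of_PC :: "('p, 'q) kb1 \<times> ('p, 'q) kb2 \<Rightarrow> ('p, 'q) kf1 \<times> ('p, 'q) kf2" where
  "FC_of_PC = (\<lambda>(\<phi>, \<psi>). (kf_of_kb1 \<phi>, KFNeg2 (kf_of_kb2 \<psi>)))"

definition neg_pair :: "('p, 'q) kb1 \<times> ('p, 'q) kb2 \<Rightarrow> ('p, 'q) kb1 \<times> ('p, 'q) kb2" where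
  "neg_pair = map_prod KBNeg1 KBNeg2"

text \<open>A pair is a concept iff each component is equivalent to the modal image of the other.
  The translation of \<open>WinInv \<psi>\<close> is the \<open>BoxInv\<close> of the new intent,
  and \<open>Dia\<close> of the new extent is the negation of the translation of
  \<open>Win \<phi>\<close>, so the two conditions carry over.\<close>

lemma PC_of_FC_closed:
  assumes "c \<in> Fm_FC K"
  shows "PC_of_FC c \<in> Fm_PC (compl_context K)"
proof -
  obtain \<phi> \<psi> where c: "c = (\<phi>, \<psi>)"
    by (cases c)
  have "kb_sat1 (compl_context K) V1 V2 g (BoxInv (KBNeg2 (kb_of_kf2 \<psi>))) \<longleftrightarrow>
      kf_sat1 K V1 V2 g (WinInv \<psi>)" if "g \<in> Obj K" for V1 V2 g
    using kb_of_kf1_sat[OF that, of V1 V2 "WinInv \<psi>"] by (simp only: kb_of_kf1.simps)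
  moreover have "kb_sat2 (compl_context K) V1 V2 m (Dia (kb_of_kf1 \<phi>)) \<longleftrightarrow>
      \<not> kf_sat2 K V1 V2 m (Win \<phi>)" if "m \<in> Att K" for V1 V2 m
    using kb_of_kf2_sat[OF that, of V1 V2 "Win \<phi>"] by auto
  ultimately show ?thesis
    \<comment> \<open>The modal truth clauses are removed from the simplifier so that the two
      equivalences just proved rewrite whole modal formulas.\<close>
    using assms by (simp add: c PC_of_FC_def in_FC_iff in_PC_iff kb_of_kf_sat
        del: kf_sat1.simps(4) kf_sat2.simps(4) kb_sat1.simps(5) kb_sat2.simps(4))
qed

lemma FC_of_PC_closed:
  assumes "c \<in> Fm_PC (compl_context K)"
  shows "FC_of_PC c \<in> Fm_FC K"
proof -
  obtain \<phi> \<psi> where c: "c = (\<phi>, \<psi>)"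
    by (cases c)
  have "kf_sat1 K V1 V2 g (WinInv (KFNeg2 (kf_of_kb2 \<psi>))) \<longleftrightarrow>
      kb_sat1 (compl_context K) V1 V2 g (BoxInv \<psi>)" if "g \<in> Obj K" for V1 V2 g
    using kf_of_kb1_sat[OF that, of V1 V2 "BoxInv \<psi>"] by (simp only: kf_of_kb1.simps)
  moreover have "kf_sat2 K V1 V2 m (Win (kf_of_kb1 \<phi>)) \<longleftrightarrow>
      \<not> kb_sat2 (compl_context K) V1 V2 m (Dia \<phi>)" if "m \<in> Att K" for V1 V2 m
    using kf_of_kb2_sat[OF that, of V1 V2 "Dia \<phi>"] by auto
  ultimately show ?thesis
    using assms by (simp add: c FC_of_PC_def in_FC_iff in_PC_iff kf_of_kb_sat
        del: kf_sat1.simps(4) kf_sat2.simps(4) kb_sat1.simps(5) kb_sat2.simps(4))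
qed

text \<open>Negation exchanges \<open>BoxInv\<close> with \<open>DiaInv\<close> and
  \<open>Dia\<close> with \<open>Box\<close>, so negating both sides of the two defining
  equivalences of one kind of concept gives those of the other, over the same context.\<close>

lemma neg_pair_PC_closed:
  assumes "c \<in> Fm_PC L"
  shows "neg_pair c \<in> Fm_OC L"
proof -
  obtain \<phi> \<psi> where c: "c = (\<phi>, \<psi>)"
    by (cases c)
  have "kb_sat1 L V1 V2 g (DiaInv (KBNeg2 \<psi>)) \<longleftrightarrow> \<not> kb_sat1 L V1 V2 g (BoxInv \<psi>)"
    and "kb_sat2 L V1 V2 m (Box (KBNeg1 \<phi>)) \<longleftrightarrow> \<not> kb_sat2 L V1 V2 m (Dia \<phi>)" for V1 V2 g m
    by auto
  then show ?thesis
    using assms by (simp add: c neg_pair_def in_PC_iff in_OC_iff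
        del: kb_sat1.simps(4,5) kb_sat2.simps(4,5))
qed

lemma neg_pair_OC_closed:
  assumes "c \<in> Fm_OC L"
  shows "neg_pair c \<in> Fm_PC L"
proof -
  obtain \<phi> \<psi> where c: "c = (\<phi>, \<psi>)"
    by (cases c)
  have "kb_sat1 L V1 V2 g (BoxInv (KBNeg2 \<psi>)) \<longleftrightarrow> \<not> kb_sat1 L V1 V2 g (DiaInv \<psi>)"
    and "kb_sat2 L V1 V2 m (Dia (KBNeg1 \<phi>)) \<longleftrightarrow> \<not> kb_sat2 L V1 V2 m (Box \<phi>)" for V1 V2 g m
    by auto
  then show ?thesis
    using assms by (simp add: c neg_pair_def in_PC_iff in_OC_iff
        del: kb_sat1.simps(4,5) kb_sat2.simps(4,5))
qed

text \<open>Classes are compared by extent, so once both pairs are known to be concepts only their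
  first components have to be evaluated.\<close>

lemma eq_PC_I:
  assumes "c \<in> Fm_PC L" "c' \<in> Fm_PC L"
    and "\<And>V1 V2 g. valuation L V1 V2 \<Longrightarrow> g \<in> Obj L \<Longrightarrow>
      kb_sat1 L V1 V2 g (fst c) \<longleftrightarrow> kb_sat1 L V1 V2 g (fst c')"
  shows "(c, c') \<in> eq_PC L"
  using assms unfolding eq_PC_def kb_valid1_iff by blast

lemma eq_OC_I:
  assumes "c \<in> Fm_OC L" "c' \<in> Fm_OC L"
    and "\<And>V1 V2 g. valuation L V1 V2 \<Longrightarrow> g \<in> Obj L \<Longrightarrow>
      kb_sat1 L V1 V2 g (fst c) \<longleftrightarrow> kb_sat1 L V1 V2 g (fst c')"
  shows "(c, c') \<in> eq_OC L"
  using assms unfolding eq_OC_def kb_valid1_iff by blast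

lemma eq_FC_I:
  assumes "c \<in> Fm_FC L" "c' \<in> Fm_FC L"
    and "\<And>V1 V2 g. valuation L V1 V2 \<Longrightarrow> g \<in> Obj L \<Longrightarrow>
      kf_sat1 L V1 V2 g (fst c) \<longleftrightarrow> kf_sat1 L V1 V2 g (fst c')"
  shows "(c, c') \<in> eq_FC L"
  using assms unfolding eq_FC_def kf_valid1_iff by blast

section \<open>The isomorphism, the dual isomorphism and their composite\<close>

lemma FC_alg_isomorphic_PC_alg:
  "alg_isomorphic (FC_alg K :: (('p, 'q) kf1 \<times> ('p, 'q) kf2) set alg)
     (PC_alg (compl_context K) :: (('p, 'q) kb1 \<times> ('p, 'q) kb2) set alg)"
  unfolding FC_alg_def PC_alg_def
proof (rule quotient_alg_isomorphic[where f = PC_of_FC and g = FC_of_PC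
      and jA = "\<lambda>(\<phi>, \<psi>) (\<phi>', \<psi>'). (WinInv (KFAnd2 \<psi> \<psi>'), KFAnd2 \<psi> \<psi>')"
      and mA = "\<lambda>(\<phi>, \<psi>) (\<phi>', \<psi>'). (KFAnd1 \<phi> \<phi>', Win (KFAnd1 \<phi> \<phi>'))"
      and jB = "\<lambda>(\<phi>, \<psi>) (\<phi>', \<psi>'). (BoxInv (KBOr2 \<psi> \<psi>'), KBOr2 \<psi> \<psi>')"
      and mB = "\<lambda>(\<phi>, \<psi>) (\<phi>', \<psi>'). (KBAnd1 \<phi> \<phi>', Dia (KBAnd1 \<phi> \<phi>'))",
      OF equiv_FC equiv_PC])
  note closed = PC_of_FC_closed FC_of_PC_closed join_FC_closed meet_FC_closed
    join_PC_closed meet_PC_closed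
  fix c c' :: "('p, 'q) kf1 \<times> ('p, 'q) kf2"
  show "(PC_of_FC c, PC_of_FC c') \<in> eq_PC (compl_context K)" if "(c, c') \<in> eq_FC K"
    \<comment> \<open>The first \<open>auto\<close> settles membership while \<open>PC_of_FC\<close>
      is still folded; the second unfolds it to compare truth values.\<close>
    using that by (cases c; cases c'; intro eq_PC_I)
      (auto simp: in_eq_FC_iff closed, auto simp: PC_of_FC_def kb_of_kf_sat)
  assume c: "c \<in> Fm_FC K"
  \<comment> \<open>The round trip need not return the same formula, but the two truth lemmas cancel
    on extents.\<close>
  then show "(FC_of_PC (PC_of_FC c), c) \<in> eq_FC K"
    by (intro eq_FC_I) (auto simp: closed, auto simp: PC_of_FC_def FC_of_PC_def
        kb_of_kf_sat kf_of_kb_sat split: prod.splits)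
  assume c': "c' \<in> Fm_FC K"
  note PC = PC_of_FC_closed[OF c] PC_of_FC_closed[OF c']
  obtain \<phi> \<psi> \<phi>' \<psi>' where eqs: "c = (\<phi>, \<psi>)" "c' = (\<phi>', \<psi>')"
    by (cases c; cases c')
  show "join_FC K (eq_FC K `` {c}) (eq_FC K `` {c'}) = eq_FC K ``
      {(\<lambda>(\<phi>, \<psi>) (\<phi>', \<psi>'). (WinInv (KFAnd2 \<psi> \<psi>'), KFAnd2 \<psi> \<psi>')) c c'}"
    using c c' by (simp add: eqs join_FC_class)
  show "meet_FC K (eq_FC K `` {c}) (eq_FC K `` {c'}) = eq_FC K ``
      {(\<lambda>(\<phi>, \<psi>) (\<phi>', \<psi>'). (KFAnd1 \<phi> \<phi>', Win (KFAnd1 \<phi> \<phi>'))) c c'}"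
    using c c' by (simp add: eqs meet_FC_class)
  show "(\<lambda>(\<phi>, \<psi>) (\<phi>', \<psi>'). (WinInv (KFAnd2 \<psi> \<psi>'), KFAnd2 \<psi> \<psi>')) c c' \<in> Fm_FC K"
    using c c' by (simp add: eqs closed)
  \<comment> \<open>De Morgan: the negated conjunction of the translated intents is the disjunction
    of the negated ones, up to double negations. This is how a join built from a conjunction of
    intents meets one built from a disjunction.\<close>
  then show "(PC_of_FC ((\<lambda>(\<phi>, \<psi>) (\<phi>', \<psi>'). (WinInv (KFAnd2 \<psi> \<psi>'), KFAnd2 \<psi> \<psi>')) c c'),
      (\<lambda>(\<phi>, \<psi>) (\<phi>', \<psi>'). (BoxInv (KBOr2 \<psi> \<psi>'), KBOr2 \<psi> \<psi>')) (PC_of_FC c) (PC_of_FC c'))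
      \<in> eq_PC (compl_context K)"
    using PC by (intro eq_PC_I)
      (auto simp: eqs closed, auto simp: PC_of_FC_def kb_of_kf_sat intro!: join_PC_closed)
  show "(\<lambda>(\<phi>, \<psi>) (\<phi>', \<psi>'). (KFAnd1 \<phi> \<phi>', Win (KFAnd1 \<phi> \<phi>'))) c c' \<in> Fm_FC K"
    using c c' by (simp add: eqs closed)
  then show "(PC_of_FC ((\<lambda>(\<phi>, \<psi>) (\<phi>', \<psi>'). (KFAnd1 \<phi> \<phi>', Win (KFAnd1 \<phi> \<phi>'))) c c'),
      (\<lambda>(\<phi>, \<psi>) (\<phi>', \<psi>'). (KBAnd1 \<phi> \<phi>', Dia (KBAnd1 \<phi> \<phi>'))) (PC_of_FC c) (PC_of_FC c'))
      \<in> eq_PC (compl_context K)"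
    using PC by (intro eq_PC_I)
      (auto simp: eqs closed, auto simp: PC_of_FC_def kb_of_kf_sat intro!: meet_PC_closed)
next
  fix d d' :: "('p, 'q) kb1 \<times> ('p, 'q) kb2"
  show "(FC_of_PC d, FC_of_PC d') \<in> eq_FC K" if "(d, d') \<in> eq_PC (compl_context K)"
    using that by (cases d; cases d'; intro eq_FC_I)
      (auto simp: in_eq_PC_iff FC_of_PC_closed, auto simp: FC_of_PC_def kf_of_kb_sat)
  assume d: "d \<in> Fm_PC (compl_context K)"
  then show "(PC_of_FC (FC_of_PC d), d) \<in> eq_PC (compl_context K)"
    by (intro eq_PC_I) (auto simp: FC_of_PC_closed PC_of_FC_closed,
        auto simp: PC_of_FC_def FC_of_PC_def kb_of_kf_sat kf_of_kb_sat split: prod.splits)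
  assume "d' \<in> Fm_PC (compl_context K)"
  with d show "join_PC (compl_context K) (eq_PC (compl_context K) `` {d})
      (eq_PC (compl_context K) `` {d'}) = eq_PC (compl_context K) ``
      {(\<lambda>(\<phi>, \<psi>) (\<phi>', \<psi>'). (BoxInv (KBOr2 \<psi> \<psi>'), KBOr2 \<psi> \<psi>')) d d'}"
    and "meet_PC (compl_context K) (eq_PC (compl_context K) `` {d})
      (eq_PC (compl_context K) `` {d'}) = eq_PC (compl_context K) ``
      {(\<lambda>(\<phi>, \<psi>) (\<phi>', \<psi>'). (KBAnd1 \<phi> \<phi>', Dia (KBAnd1 \<phi> \<phi>'))) d d'}"
    by (auto simp: join_PC_class meet_PC_class split: prod.splits)
qed

lemma PC_alg_dually_isomorphic_OC_alg:
  "alg_dually_isomorphic (PC_alg L :: (('p, 'q) kb1 \<times> ('p, 'q) kb2) set alg)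
     (OC_alg L :: (('p, 'q) kb1 \<times> ('p, 'q) kb2) set alg)"
  unfolding PC_alg_def OC_alg_def alg_dually_isomorphic_iff
\<comment> \<open>The target operations have been swapped, so \<open>jB\<close> computes the meet
  and \<open>mB\<close> the join of object oriented concepts. \<open>neg_pair\<close> is its own
  inverse up to double negation.\<close>
proof (rule quotient_alg_isomorphic[where f = neg_pair and g = neg_pair
      and jA = "\<lambda>(\<phi>, \<psi>) (\<phi>', \<psi>'). (BoxInv (KBOr2 \<psi> \<psi>'), KBOr2 \<psi> \<psi>')"
      and mA = "\<lambda>(\<phi>, \<psi>) (\<phi>', \<psi>'). (KBAnd1 \<phi> \<phi>', Dia (KBAnd1 \<phi> \<phi>'))"
      and jB = "\<lambda>(\<phi>, \<psi>) (\<phi>', \<psi>'). (DiaInv (KBAnd2 \<psi> \<psi>'), KBAnd2 \<psi> \<psi>')"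
      and mB = "\<lambda>(\<phi>, \<psi>) (\<phi>', \<psi>'). (KBOr1 \<phi> \<phi>', Box (KBOr1 \<phi> \<phi>'))",
      OF equiv_PC equiv_OC])
  note closed = neg_pair_PC_closed neg_pair_OC_closed
  fix c c' :: "('p, 'q) kb1 \<times> ('p, 'q) kb2"
  show "(neg_pair c, neg_pair c') \<in> eq_OC L" if "(c, c') \<in> eq_PC L"
    using that by (cases c; cases c'; intro eq_OC_I)
      (auto simp: in_eq_PC_iff closed, auto simp: neg_pair_def)
  show "(neg_pair c, neg_pair c') \<in> eq_PC L" if "(c, c') \<in> eq_OC L"
    using that by (cases c; cases c'; intro eq_PC_I)
      (auto simp: in_eq_OC_iff closed, auto simp: neg_pair_def)
  show "(neg_pair (neg_pair c), c) \<in> eq_PC L" if "c \<in> Fm_PC L"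
    using that by (intro eq_PC_I) (auto simp: closed, auto simp: neg_pair_def)
  show "(neg_pair (neg_pair c), c) \<in> eq_OC L" if "c \<in> Fm_OC L"
    using that by (intro eq_OC_I) (auto simp: closed, auto simp: neg_pair_def)
  obtain \<phi> \<psi> \<phi>' \<psi>' where eqs: "c = (\<phi>, \<psi>)" "c' = (\<phi>', \<psi>')"
    by (cases c; cases c')
  \<comment> \<open>Source and target concepts have the same type here, so the same \<open>c\<close>
    and \<open>c'\<close> also serve for the target; the block keeps their membership in
    \<open>Fm_OC L\<close> local.\<close>
  {
    assume c: "c \<in> Fm_OC L" "c' \<in> Fm_OC L"
    show "meet_OC L (eq_OC L `` {c}) (eq_OC L `` {c'}) = eq_OC L ``
        {(\<lambda>(\<phi>, \<psi>) (\<phi>', \<psi>'). (DiaInv (KBAnd2 \<psi> \<psi>'), KBAnd2 \<psi> \<psi>')) c c'}"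
      using c by (simp add: eqs meet_OC_class)
    show "join_OC L (eq_OC L `` {c}) (eq_OC L `` {c'}) = eq_OC L ``
        {(\<lambda>(\<phi>, \<psi>) (\<phi>', \<psi>'). (KBOr1 \<phi> \<phi>', Box (KBOr1 \<phi> \<phi>'))) c c'}"
      using c by (simp add: eqs join_OC_class)
  }
  assume c: "c \<in> Fm_PC L" and c': "c' \<in> Fm_PC L"
  note OC = neg_pair_PC_closed[OF c] neg_pair_PC_closed[OF c']
  show "join_PC L (eq_PC L `` {c}) (eq_PC L `` {c'}) = eq_PC L ``
      {(\<lambda>(\<phi>, \<psi>) (\<phi>', \<psi>'). (BoxInv (KBOr2 \<psi> \<psi>'), KBOr2 \<psi> \<psi>')) c c'}"
    using c c' by (simp add: eqs join_PC_class)
  show "meet_PC L (eq_PC L `` {c}) (eq_PC L `` {c'}) = eq_PC L ``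
      {(\<lambda>(\<phi>, \<psi>) (\<phi>', \<psi>'). (KBAnd1 \<phi> \<phi>', Dia (KBAnd1 \<phi> \<phi>'))) c c'}"
    using c c' by (simp add: eqs meet_PC_class)
  show "(\<lambda>(\<phi>, \<psi>) (\<phi>', \<psi>'). (BoxInv (KBOr2 \<psi> \<psi>'), KBOr2 \<psi> \<psi>')) c c' \<in> Fm_PC L"
    using c c' by (simp add: eqs join_PC_closed)
  \<comment> \<open>The negated box of a disjunction is the diamond of the conjunction of
    negations.\<close>
  then show "(neg_pair ((\<lambda>(\<phi>, \<psi>) (\<phi>', \<psi>'). (BoxInv (KBOr2 \<psi> \<psi>'), KBOr2 \<psi> \<psi>')) c c'),
      (\<lambda>(\<phi>, \<psi>) (\<phi>', \<psi>'). (DiaInv (KBAnd2 \<psi> \<psi>'), KBAnd2 \<psi> \<psi>')) (neg_pair c) (neg_pair c'))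
      \<in> eq_OC L"
    using OC by (intro eq_OC_I)
      (auto simp: eqs closed, auto simp: neg_pair_def intro!: meet_OC_closed)
  show "(\<lambda>(\<phi>, \<psi>) (\<phi>', \<psi>'). (KBAnd1 \<phi> \<phi>', Dia (KBAnd1 \<phi> \<phi>'))) c c' \<in> Fm_PC L"
    using c c' by (simp add: eqs meet_PC_closed)
  then show "(neg_pair ((\<lambda>(\<phi>, \<psi>) (\<phi>', \<psi>'). (KBAnd1 \<phi> \<phi>', Dia (KBAnd1 \<phi> \<phi>'))) c c'),
      (\<lambda>(\<phi>, \<psi>) (\<phi>', \<psi>'). (KBOr1 \<phi> \<phi>', Box (KBOr1 \<phi> \<phi>'))) (neg_pair c) (neg_pair c'))
      \<in> eq_OC L"
    using OC by (intro eq_OC_I)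
      (auto simp: eqs closed, auto simp: neg_pair_def intro!: join_OC_closed)
qed

theorem theorem8:
  fixes K :: "('g, 'm) ctxt"
  assumes "formal_context K"
  shows "alg_isomorphic
           (FC_alg K :: (('p, 'q) kf1 \<times> ('p, 'q) kf2) set alg)
           (PC_alg (compl_context K) :: (('p, 'q) kb1 \<times> ('p, 'q) kb2) set alg)
       \<and> alg_dually_isomorphic
           (PC_alg (compl_context K) :: (('p, 'q) kb1 \<times> ('p, 'q) kb2) set alg)
           (OC_alg (compl_context K) :: (('p, 'q) kb1 \<times> ('p, 'q) kb2) set alg)
       \<and> alg_dually_isomorphic
           (FC_alg K :: (('p, 'q) kf1 \<times> ('p, 'q) kf2) set alg)
           (OC_alg (compl_context K) :: (('p, 'q) kb1 \<times> ('p, 'q) kb2) set alg)"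
  \<comment> \<open>The third claim composes the first with the second, the latter read as an
    isomorphism onto the algebra with join and meet exchanged.\<close>
  using FC_alg_isomorphic_PC_alg PC_alg_dually_isomorphic_OC_alg
    alg_isomorphic_trans[OF FC_alg_isomorphic_PC_alg[unfolded FC_alg_def PC_alg_def]
      PC_alg_dually_isomorphic_OC_alg[unfolded PC_alg_def OC_alg_def alg_dually_isomorphic_iff]]
  unfolding FC_alg_def OC_alg_def alg_dually_isomorphic_iff by blast

end
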